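(* The energy momentum tensor $T$ of the Vaidya-Bonner-de Sitter spacetime has the following properties: (i) $Q(T,R)=-2\lambda\, Q(g,R)+Q(S,R)$; (ii) $T$ is compatible for the Riemann $R$, projective $P$, conformal $C$, concircular $cir(R)$ and conharmonic $har(R)$ curvature tensors.
   Context: The Vaidya-Bonner-de Sitter (VBdS) spacetime is the $4$-dimensional Lorentzian manifold with coordinates $(x^1,x^2,x^3,x^4)=(t,r,\theta,\phi)$ and metric $ds^2=\left(1-\frac{2m(t)}{r}+\frac{q^2(t)}{r^2}-\frac{\lambda r^2}{3}\right)dt^2-2\,dt\,dr-r^2(d\theta^2+\sin^2\theta\, d\phi^2)$, where $\lambda$ is the cosmological constant and the mass $m=m(t)$ and charge $q=q(t)$ depend on $t$; $m'=\frac{dm}{dt}$ and $(q^2)'=\frac{d(q^2)}{dt}$. Curvature conventions: $R_{efst}=g_{e\alpha}(\partial_s\Gamma^\alpha_{ft}-\partial_t\Gamma^\alpha_{fs}+\Gamma^\beta_{ft}\Gamma^\alpha_{\beta s}-\Gamma^\beta_{fs}\Gamma^\alpha_{\beta t})$, Ricci tensor $S_{fs}=g^{et}R_{efst}$, scalar curvature $\bar\kappa=g^{fs}S_{fs}$. The energy momentum tensor $T$ is introduced by $S-\frac{\bar\kappa}{2}g+\Lambda g=\frac{8\pi G}{c^4}T$, where $\Lambda$ is the cosmological constant, $G$ the gravitational constant and $c$ the speed of light in vacuum, and it is assumed that $\frac{8\pi G}{c^4}=1$. Its non-zero components (up to symmetry) are given as $T_{11}=\frac{r^6\lambda(-3+r^2\lambda)-r^2(3+2r^2\lambda)q^2-3q^4+6rm(r^4\lambda+q^2)+3r^3(-2rm'+(q^2)')}{3r^6}$,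 $T_{12}=\lambda+\frac{q^2}{r^4}$, $T_{33}=\frac{r^4\lambda-q^2}{r^2}$, $T_{44}=\frac{(r^4\lambda-q^2)\sin^2\theta}{r^2}$. For symmetric $(0,2)$ tensors $X,Z$ the Kulkarni-Nomizu product is $(X\wedge Z)_{efst}=X_{et}Z_{fs}+X_{fs}Z_{et}-X_{es}Z_{ft}-X_{ft}Z_{es}$. In dimension $4$: $har(R)=R-\frac12 g\wedge S$; $cir(R)=R-\frac{\bar\kappa}{24}g\wedge g$; $C=R-\frac12 g\wedge S+\frac{\bar\kappa}{12}g\wedge g$; $P_{efst}=R_{efst}-\frac13(g_{et}S_{fs}-g_{ft}S_{es})$. For a symmetric $(0,2)$ tensor $\beta$ and a $(0,m)$ tensor $W$: $Q(\beta,W)_{b_1\cdots b_m rs}=\beta_{sb_1}W_{rb_2\cdots b_m}+\cdots+\beta_{sb_m}W_{b_1\cdots b_{m-1}r}-\beta_{rb_1}W_{sb_2\cdots b_m}-\cdots-\beta_{rb_m}W_{b_1\cdots b_{m-1}s}$. A symmetric $(0,2)$ tensor $H$ is compatible for a $(0,4)$ tensor $D$ if the cyclic sum over $e,f,s$ of $H_e{}^d D_{fstd}$ vanishes, with $H_e{}^d=g^{d\alpha}H_{e\alpha}$. *)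

theory Defs
  imports "HOL-Analysis.Analysis"
begin

text \<open>
  Points are coordinate vectors in \<^typ>\<open>real ^ 4\<close>, a (0,2) tensor at a point is its component matrix
  \<^typ>\<open>real ^ 4 ^ 4\<close>, and a (0,4) tensor at a point is its component function
  \<^typ>\<open>4 \<Rightarrow> 4 \<Rightarrow> 4 \<Rightarrow> 4 \<Rightarrow> real\<close>. In the index type \<^typ>\<open>4\<close> the numeral \<open>4\<close> equals \<open>0\<close>, so
  \<open>1, 2, 3, 4\<close> enumerate it.
\<close>

type_synonym point = "real ^ 4"
type_synonym tensor2 = "real ^ 4 ^ 4"
type_synonym tensor4 = "4 \<Rightarrow> 4 \<Rightarrow> 4 \<Rightarrow> 4 \<Rightarrow> real"

definition partial :: "4 \<Rightarrow> (point \<Rightarrow> real) \<Rightarrow> point \<Rightarrow> real" where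
  "partial k f x = deriv (\<lambda>h. f (x + h *\<^sub>R axis k 1)) 0"

definition ginv :: "(point \<Rightarrow> tensor2) \<Rightarrow> point \<Rightarrow> tensor2" where
  "ginv g x = matrix_inv (g x)"

text \<open>\<open>christoffel g a i j\<close> is the symbol with upper index \<open>a\<close> and lower indices \<open>i\<close>, \<open>j\<close>.\<close>

definition christoffel :: "(point \<Rightarrow> tensor2) \<Rightarrow> 4 \<Rightarrow> 4 \<Rightarrow> 4 \<Rightarrow> point \<Rightarrow> real" where
  "christoffel g a i j x =
     (\<Sum>l\<in>UNIV. ginv g x $ a $ l *
        (partial i (\<lambda>y. g y $ j $ l) x + partial j (\<lambda>y. g y $ i $ l) x
           - partial l (\<lambda>y. g y $ i $ j) x)) / 2"

definition riemann :: "(point \<Rightarrow> tensor2) \<Rightarrow> point \<Rightarrow> tensor4" where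
  "riemann g x e f s t =
     (\<Sum>a\<in>UNIV. g x $ e $ a *
        (partial s (christoffel g a f t) x - partial t (christoffel g a f s) x
         + (\<Sum>b\<in>UNIV. christoffel g b f t x * christoffel g a b s x
                      - christoffel g b f s x * christoffel g a b t x)))"

text \<open>
  The trace is over the first and the last index, which is the negative of the more common
  Ricci tensor obtained from the same \<open>riemann\<close>.
\<close>

definition ricci :: "(point \<Rightarrow> tensor2) \<Rightarrow> point \<Rightarrow> tensor2" where
  "ricci g x = (\<chi> f s. \<Sum>e\<in>UNIV. \<Sum>t\<in>UNIV. ginv g x $ e $ t * riemann g x e f s t)"

definition scalar_curv :: "(point \<Rightarrow> tensor2) \<Rightarrow> point \<Rightarrow> real" where
  "scalar_curv g x = (\<Sum>f\<in>UNIV. \<Sum>s\<in>UNIV. ginv g x $ f $ s * ricci g x $ f $ s)"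

definition kulkarni_nomizu :: "tensor2 \<Rightarrow> tensor2 \<Rightarrow> tensor4" where
  "kulkarni_nomizu X Z e f s t =
     X $ e $ t * Z $ f $ s + X $ f $ s * Z $ e $ t - X $ e $ s * Z $ f $ t - X $ f $ t * Z $ e $ s"

definition conharmonic :: "(point \<Rightarrow> tensor2) \<Rightarrow> point \<Rightarrow> tensor4" where
  "conharmonic g x e f s t =
     riemann g x e f s t - 1/2 * kulkarni_nomizu (g x) (ricci g x) e f s t"

definition concircular :: "(point \<Rightarrow> tensor2) \<Rightarrow> point \<Rightarrow> tensor4" where
  "concircular g x e f s t =
     riemann g x e f s t - scalar_curv g x / 24 * kulkarni_nomizu (g x) (g x) e f s t"

definition conformal :: "(point \<Rightarrow> tensor2) \<Rightarrow> point \<Rightarrow> tensor4" where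
  "conformal g x e f s t =
     riemann g x e f s t - 1/2 * kulkarni_nomizu (g x) (ricci g x) e f s t
       + scalar_curv g x / 12 * kulkarni_nomizu (g x) (g x) e f s t"

definition projective :: "(point \<Rightarrow> tensor2) \<Rightarrow> point \<Rightarrow> tensor4" where
  "projective g x e f s t =
     riemann g x e f s t
       - 1/3 * (g x $ e $ t * ricci g x $ f $ s - g x $ f $ t * ricci g x $ e $ s)"

text \<open>The tensor \<open>Q(\<beta>, W)\<close> for \<open>W\<close> of type (0,4).\<close>

definition tachibana :: "tensor2 \<Rightarrow> tensor4 \<Rightarrow> 4 \<Rightarrow> 4 \<Rightarrow> 4 \<Rightarrow> 4 \<Rightarrow> 4 \<Rightarrow> 4 \<Rightarrow> real" where
  "tachibana \<beta> W b1 b2 b3 b4 r s =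
       \<beta> $ s $ b1 * W r b2 b3 b4 + \<beta> $ s $ b2 * W b1 r b3 b4
     + \<beta> $ s $ b3 * W b1 b2 r b4 + \<beta> $ s $ b4 * W b1 b2 b3 r
     - \<beta> $ r $ b1 * W s b2 b3 b4 - \<beta> $ r $ b2 * W b1 s b3 b4
     - \<beta> $ r $ b3 * W b1 b2 s b4 - \<beta> $ r $ b4 * W b1 b2 b3 s"

definition raise_index :: "(point \<Rightarrow> tensor2) \<Rightarrow> point \<Rightarrow> tensor2 \<Rightarrow> 4 \<Rightarrow> 4 \<Rightarrow> real" where
  "raise_index g x H e d = (\<Sum>a\<in>UNIV. ginv g x $ d $ a * H $ e $ a)"

definition compatible_at :: "(point \<Rightarrow> tensor2) \<Rightarrow> point \<Rightarrow> tensor2 \<Rightarrow> tensor4 \<Rightarrow> bool" where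
  "compatible_at g x H D \<longleftrightarrow>
     (\<forall>e f s t. (\<Sum>d\<in>UNIV. raise_index g x H e d * D f s t d)
              + (\<Sum>d\<in>UNIV. raise_index g x H f d * D s e t d)
              + (\<Sum>d\<in>UNIV. raise_index g x H s d * D e f t d) = 0)"

text \<open>
  The coordinates \<open>(x $ 1, x $ 2, x $ 3, x $ 4)\<close> are \<open>(t, r, \<theta>, \<phi>)\<close>. The set \<open>I\<close> is the range of
  \<open>t\<close>, where \<open>m\<close> and \<open>q\<close> are given. Nothing depends on \<open>\<phi>\<close>, which is left unrestricted.
\<close>

definition vbds_chart :: "real set \<Rightarrow> point set" where
  "vbds_chart I = {x. x $ 1 \<in> I \<and> 0 < x $ 2 \<and> 0 < x $ 3 \<and> x $ 3 < pi}"

definition vbds_metric :: "(real \<Rightarrow> real) \<Rightarrow> (real \<Rightarrow> real) \<Rightarrow> real \<Rightarrow> point \<Rightarrow> tensor2" where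
  "vbds_metric m q lam x =
     (let t = x $ 1; r = x $ 2; \<theta> = x $ 3 in
      vector [
        vector [1 - 2 * m t / r + (q t)\<^sup>2 / r\<^sup>2 - lam * r\<^sup>2 / 3, -1, 0, 0],
        vector [-1, 0, 0, 0],
        vector [0, 0, - r\<^sup>2, 0],
        vector [0, 0, 0, - r\<^sup>2 * (sin \<theta>)\<^sup>2]])"

definition vbds_energy_momentum ::
    "(real \<Rightarrow> real) \<Rightarrow> (real \<Rightarrow> real) \<Rightarrow> real \<Rightarrow> point \<Rightarrow> tensor2" where
  "vbds_energy_momentum m q lam x =
     (let t = x $ 1; r = x $ 2; \<theta> = x $ 3; m' = deriv m t; Q = (q t)\<^sup>2;
          Q' = deriv (\<lambda>u. (q u)\<^sup>2) t;
          T11 = (r^6 * lam * (-3 + r\<^sup>2 * lam) - r\<^sup>2 * (3 + 2 * r\<^sup>2 * lam) * Q - 3 * Q\<^sup>2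
                 + 6 * r * m t * (r^4 * lam + Q) + 3 * r^3 * (-2 * r * m' + Q')) / (3 * r^6);
          T12 = lam + Q / r^4;
          T33 = (r^4 * lam - Q) / r\<^sup>2;
          T44 = (r^4 * lam - Q) * (sin \<theta>)\<^sup>2 / r\<^sup>2
      in vector [
        vector [T11, T12, 0, 0],
        vector [T12, 0, 0, 0],
        vector [0, 0, T33, 0],
        vector [0, 0, 0, T44]])"

text \<open>
  The components above are those of the field equation \<open>S - (\<kappa>/2) g + \<Lambda> g = T\<close> with \<open>\<Lambda> = 0\<close>;
  the parameter \<open>lam\<close> enters only through the metric. This is theorem \<open>vbds_field_equation\<close>,
  to which the rest of this theory is devoted. The functions \<open>vbds_gtab\<close>, \<open>vbds_itab\<close>, \<open>vbds_dg\<close>,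
  \<open>vbds_Gam\<close>, \<open>vbds_dGam\<close>, \<open>vbds_Riem\<close> (first index raised) and \<open>vbds_S\<close> are closed forms of
  the metric, its inverse and partial derivatives, the Christoffel symbols and their partial
  derivatives, the curvature and the Ricci tensor; no definition above depends on them.
\<close>

lemma vector_4_nth [simp]:
  "(vector [a, b, c, d] :: 'a::zero ^ 4) $ 1 = a"
  "(vector [a, b, c, d] :: 'a ^ 4) $ 2 = b"
  "(vector [a, b, c, d] :: 'a ^ 4) $ 3 = c"
  "(vector [a, b, c, d] :: 'a ^ 4) $ 4 = d"
  unfolding vector_def by simp_all

lemma axis_4_nth[simp]: "axis (1::4) (1::real) $ 2 = 0" "axis (1::4) (1::real) $ 3 = 0" "axis (1::4) (1::real) $ 1 = 1"
  "axis (2::4) (1::real) $ 1 = 0" "axis (2::4) (1::real) $ 3 = 0" "axis (2::4) (1::real) $ 2 = 1"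
  "axis (3::4) (1::real) $ 2 = 0" "axis (3::4) (1::real) $ 1 = 0" "axis (3::4) (1::real) $ 3 = 1"
  "axis (4::4) (1::real) $ 2 = 0" "axis (4::4) (1::real) $ 1 = 0" "axis (4::4) (1::real) $ 3 = 0"
  by (simp_all add: axis_def)

lemma open_vbds_chart: assumes "open I" shows "open (vbds_chart I)"
proof -
  have "vbds_chart I = ((\<lambda>x. x $ 1) -` I) \<inter> ((\<lambda>x. x $ 2) -` {0<..}) \<inter> ((\<lambda>x. x $ 3) -` {0<..<pi})"
    by (auto simp: vbds_chart_def)
  thus ?thesis using assms by (auto intro!: open_Int open_vimage_vec_nth)
qed

lemma partial_transfer:
  assumes "open S" "x \<in> S" "\<And>y. y \<in> S \<Longrightarrow> f y = F (y $ 1) (y $ 2) (y $ 3)"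
  shows "partial k f x = deriv (\<lambda>h. F (x $ 1 + h * axis k 1 $ 1) (x $ 2 + h * axis k 1 $ 2) (x $ 3 + h * axis k 1 $ 3)) 0"
  unfolding partial_def
proof (rule deriv_cong_ev)
  have "continuous (at 0) (\<lambda>h::real. x + h *\<^sub>R axis k 1)" by (intro continuous_intros)
  hence "((\<lambda>h::real. x + h *\<^sub>R axis k 1) \<longlongrightarrow> x) (nhds 0)"
    by (simp add: isCont_def tendsto_nhds_iff)
  hence "eventually (\<lambda>h. x + h *\<^sub>R axis k 1 \<in> S) (nhds 0)"
    using assms(1,2) topological_tendstoD by blast
  thus "eventually (\<lambda>h. f (x + h *\<^sub>R axis k 1) = F (x $ 1 + h * axis k 1 $ 1) (x $ 2 + h * axis k 1 $ 2) (x $ 3 + h * axis k 1 $ 3)) (nhds 0)"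
    by eventually_elim (simp add: assms(3))
qed simp

lemma deriv_shift_arg: "(F has_real_derivative D) (at a) \<Longrightarrow> deriv (\<lambda>h. F (a + h)) 0 = D"
  using DERIV_shift[of F D 0 a] by (intro DERIV_imp_deriv) (simp add: add.commute)

lemma partial_eqI:
  assumes "open S" "x \<in> S" "\<And>y. y \<in> S \<Longrightarrow> f y = F (y $ 1) (y $ 2) (y $ 3)"
  shows "((\<lambda>u. F u (x $ 2) (x $ 3)) has_real_derivative D) (at (x $ 1)) \<Longrightarrow> partial 1 f x = D"
    "((\<lambda>u. F (x $ 1) u (x $ 3)) has_real_derivative D) (at (x $ 2)) \<Longrightarrow> partial 2 f x = D"
    "((\<lambda>u. F (x $ 1) (x $ 2) u) has_real_derivative D) (at (x $ 3)) \<Longrightarrow> partial 3 f x = D"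
    "partial 4 f x = 0"
  using deriv_shift_arg[of "\<lambda>u. F u (x $ 2) (x $ 3)"] deriv_shift_arg[of "\<lambda>u. F (x $ 1) u (x $ 3)"] deriv_shift_arg[of "\<lambda>u. F (x $ 1) (x $ 2) u"]
  by (simp_all add: partial_transfer[where f=f and F=F, OF assms])

definition vbds_f :: "(real \<Rightarrow> real) \<Rightarrow> (real \<Rightarrow> real) \<Rightarrow> real \<Rightarrow> real \<Rightarrow> real \<Rightarrow> real" where
  "vbds_f m q lam t r = 1 - 2 * m t / r + (q t)\<^sup>2 / r\<^sup>2 - lam * r\<^sup>2 / 3"
definition vbds_f_t :: "(real \<Rightarrow> real) \<Rightarrow> (real \<Rightarrow> real) \<Rightarrow> real \<Rightarrow> real \<Rightarrow> real" where
  "vbds_f_t m q t r = - 2 * deriv m t / r + 2 * q t * deriv q t / r\<^sup>2"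
definition vbds_f_r :: "(real \<Rightarrow> real) \<Rightarrow> (real \<Rightarrow> real) \<Rightarrow> real \<Rightarrow> real \<Rightarrow> real \<Rightarrow> real" where
  "vbds_f_r m q lam t r = 2 * m t / r\<^sup>2 - 2 * (q t)\<^sup>2 / r^3 - 2 * lam * r / 3"
definition vbds_f_tt :: "(real \<Rightarrow> real) \<Rightarrow> (real \<Rightarrow> real) \<Rightarrow> real \<Rightarrow> real \<Rightarrow> real" where
  "vbds_f_tt m q t r = - 2 * deriv (deriv m) t / r + 2 * (q t * deriv (deriv q) t + (deriv q t)\<^sup>2) / r\<^sup>2"
definition vbds_f_tr :: "(real \<Rightarrow> real) \<Rightarrow> (real \<Rightarrow> real) \<Rightarrow> real \<Rightarrow> real \<Rightarrow> real" where
  "vbds_f_tr m q t r = 2 * deriv m t / r\<^sup>2 - 4 * q t * deriv q t / r^3"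
definition vbds_f_rr :: "(real \<Rightarrow> real) \<Rightarrow> (real \<Rightarrow> real) \<Rightarrow> real \<Rightarrow> real \<Rightarrow> real \<Rightarrow> real" where
  "vbds_f_rr m q lam t r = - 4 * m t / r^3 + 6 * (q t)\<^sup>2 / r^4 - 2 * lam / 3"

definition vbds_gtab :: "(real \<Rightarrow> real \<Rightarrow> real) \<Rightarrow> 4 \<Rightarrow> 4 \<Rightarrow> real \<Rightarrow> real \<Rightarrow> real \<Rightarrow> real" where
  "vbds_gtab f i j t r h = (if i = 1 \<and> j = 1 then f t r else if i = 1 \<and> j = 2 \<or> i = 2 \<and> j = 1 then -1
     else if i = 3 \<and> j = 3 then - r\<^sup>2 else if i = 4 \<and> j = 4 then - r\<^sup>2 * (sin h)\<^sup>2 else 0)"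

lemma vbds_metric_nth: "vbds_metric m q lam x $ i $ j = vbds_gtab (vbds_f m q lam) i j (x$1) (x$2) (x$3)"
  using exhaust_4[of i] exhaust_4[of j]
  by (auto simp: vbds_metric_def Let_def vbds_gtab_def vbds_f_def)

definition vbds_itab :: "(real \<Rightarrow> real \<Rightarrow> real) \<Rightarrow> 4 \<Rightarrow> 4 \<Rightarrow> real \<Rightarrow> real \<Rightarrow> real \<Rightarrow> real" where
  "vbds_itab f i j t r h = (if i = 2 \<and> j = 2 then - f t r else if i = 1 \<and> j = 2 \<or> i = 2 \<and> j = 1 then -1
     else if i = 3 \<and> j = 3 then - (1 / r\<^sup>2) else if i = 4 \<and> j = 4 then - (1 / (r\<^sup>2 * (sin h)\<^sup>2)) else 0)"

definition vbds_Gam :: "(real \<Rightarrow> real \<Rightarrow> real) \<Rightarrow> (real \<Rightarrow> real \<Rightarrow> real) \<Rightarrow> (real \<Rightarrow> real \<Rightarrow> real) \<Rightarrow> 4 \<Rightarrow> 4 \<Rightarrow> 4 \<Rightarrow> real \<Rightarrow> real \<Rightarrow> real \<Rightarrow> real" where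
  "vbds_Gam f ft fr a i j t r h =
    (if a = 1 then
       (if i = 1 \<and> j = 1 then fr t r / 2 else if i = 3 \<and> j = 3 then - r
        else if i = 4 \<and> j = 4 then - r * (sin h)\<^sup>2 else 0)
     else if a = 2 then
       (if i = 1 \<and> j = 1 then - ft t r / 2 + f t r * fr t r / 2
        else if i = 1 \<and> j = 2 \<or> i = 2 \<and> j = 1 then - fr t r / 2
        else if i = 3 \<and> j = 3 then - f t r * r
        else if i = 4 \<and> j = 4 then - f t r * r * (sin h)\<^sup>2 else 0)
     else if a = 3 then
       (if i = 2 \<and> j = 3 \<or> i = 3 \<and> j = 2 then 1 / r
        else if i = 4 \<and> j = 4 then - sin h * cos h else 0)
     else
       (if i = 2 \<and> j = 4 \<or> i = 4 \<and> j = 2 then 1 / r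
        else if i = 3 \<and> j = 4 \<or> i = 4 \<and> j = 3 then cos h / sin h else 0))"

context
  fixes m q :: "real \<Rightarrow> real" and lam :: real and I :: "real set"
  assumes I: "open I"
    and m: "\<And>t. t \<in> I \<Longrightarrow> m differentiable (at t) \<and> deriv m differentiable (at t)"
    and q: "\<And>t. t \<in> I \<Longrightarrow> q differentiable (at t) \<and> deriv q differentiable (at t)"
begin

lemma vbds_mq_derivs:
  assumes "t \<in> I"
  shows "(m has_real_derivative deriv m t) (at t)" "(deriv m has_real_derivative deriv (deriv m) t) (at t)"
    "(q has_real_derivative deriv q t) (at t)" "(deriv q has_real_derivative deriv (deriv q) t) (at t)"
  using m[OF assms] q[OF assms] by (auto simp: DERIV_deriv_iff_real_differentiable)

lemma vbds_f_derivs: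
  assumes "t \<in> I" "r \<noteq> 0"
  shows "((\<lambda>t. (vbds_f m q lam) t r) has_real_derivative (vbds_f_t m q) t r) (at t)"
    "((\<lambda>t. (vbds_f_t m q) t r) has_real_derivative (vbds_f_tt m q) t r) (at t)"
    "((\<lambda>t. (vbds_f_r m q lam) t r) has_real_derivative (vbds_f_tr m q) t r) (at t)"
    "((\<lambda>r. (vbds_f m q lam) t r) has_real_derivative (vbds_f_r m q lam) t r) (at r)"
    "((\<lambda>r. (vbds_f_t m q) t r) has_real_derivative (vbds_f_tr m q) t r) (at r)"
    "((\<lambda>r. (vbds_f_r m q lam) t r) has_real_derivative (vbds_f_rr m q lam) t r) (at r)"
  unfolding vbds_f_def vbds_f_t_def vbds_f_r_def vbds_f_tt_def vbds_f_tr_def vbds_f_rr_def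
  by (insert assms; rule DERIV_cong, (rule derivative_eq_intros vbds_mq_derivs refl | assumption | simp)+,
      simp add: divide_simps, simp add: eval_nat_numeral algebra_simps)+

lemma vbds_chart_nz:
  assumes "x \<in> vbds_chart I"
  shows "x$1 \<in> I" "x$2 \<noteq> 0" "sin (x$3) \<noteq> 0"
proof -
  have "0 < sin (x$3)" using assms by (intro sin_gt_zero) (auto simp: vbds_chart_def)
  thus "x$1 \<in> I" "x$2 \<noteq> 0" "sin (x$3) \<noteq> 0" using assms by (auto simp: vbds_chart_def)
qed

lemma ginv_vbds:
  assumes "x \<in> vbds_chart I"
  shows "ginv (vbds_metric m q lam) x $ i $ j = vbds_itab (vbds_f m q lam) i j (x$1) (x$2) (x$3)"
proof -
  let ?B = "(\<chi> i j. vbds_itab (vbds_f m q lam) i j (x$1) (x$2) (x$3)) :: real^4^4"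
  note nz = vbds_chart_nz(2,3)[OF assms]
  have 1: "(vbds_metric m q lam) x ** ?B = mat 1"
  proof -
    have "((vbds_metric m q lam) x ** ?B) $ i $ j = mat 1 $ i $ j" for i j
      using exhaust_4[of i] exhaust_4[of j]
      unfolding matrix_matrix_mult_def sum_4 vbds_metric_nth mat_def vec_lambda_beta
      by (elim disjE) (use nz in \<open>simp_all add: vbds_gtab_def vbds_itab_def\<close>)
    thus ?thesis by (simp add: vec_eq_iff)
  qed
  have 2: "?B ** (vbds_metric m q lam) x = mat 1"
  proof -
    have "(?B ** (vbds_metric m q lam) x) $ i $ j = mat 1 $ i $ j" for i j
      using exhaust_4[of i] exhaust_4[of j]
      unfolding matrix_matrix_mult_def sum_4 vbds_metric_nth mat_def vec_lambda_beta
      by (elim disjE) (use nz in \<open>simp_all add: vbds_gtab_def vbds_itab_def\<close>)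
    thus ?thesis by (simp add: vec_eq_iff)
  qed
  have "\<exists>B. (vbds_metric m q lam) x ** B = mat 1 \<and> B ** (vbds_metric m q lam) x = mat 1" using 1 2 by blast
  hence "matrix_inv ((vbds_metric m q lam) x) ** (vbds_metric m q lam) x = mat 1" unfolding matrix_inv_def by (rule someI2_ex) simp
  hence "?B = (matrix_inv ((vbds_metric m q lam) x) ** (vbds_metric m q lam) x) ** ?B" by (simp only: matrix_mul_lid)
  also have "\<dots> = matrix_inv ((vbds_metric m q lam) x) ** ((vbds_metric m q lam) x ** ?B)" by (simp only: matrix_mul_assoc)
  also have "\<dots> = matrix_inv ((vbds_metric m q lam) x)" by (simp only: 1 matrix_mul_rid)
  finally have "matrix_inv ((vbds_metric m q lam) x) = ?B" by (rule sym)
  thus ?thesis by (simp add: ginv_def)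
qed

lemma partial_vbds_chart:
  assumes "x \<in> vbds_chart I" "\<And>y. y \<in> vbds_chart I \<Longrightarrow> w y = F (y $ 1) (y $ 2) (y $ 3)"
    "((\<lambda>u. F u (x $ 2) (x $ 3)) has_real_derivative D 1) (at (x $ 1))"
    "((\<lambda>u. F (x $ 1) u (x $ 3)) has_real_derivative D 2) (at (x $ 2))"
    "((\<lambda>u. F (x $ 1) (x $ 2) u) has_real_derivative D 3) (at (x $ 3))"
    "D 4 = 0"
  shows "partial k w x = D k"
  using exhaust_4[of k] partial_eqI[OF open_vbds_chart[OF I] assms(1), of w F, OF assms(2)] assms(3-) by auto

definition vbds_dg :: "4 \<Rightarrow> 4 \<Rightarrow> real \<Rightarrow> real \<Rightarrow> real \<Rightarrow> 4 \<Rightarrow> real" where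
  "vbds_dg i j t r h k =
    (if i = 1 \<and> j = 1 then (if k = 1 then (vbds_f_t m q) t r else if k = 2 then (vbds_f_r m q lam) t r else 0)
     else if i = 3 \<and> j = 3 then (if k = 2 then - 2 * r else 0)
     else if i = 4 \<and> j = 4 then (if k = 2 then - 2 * r * (sin h)\<^sup>2
       else if k = 3 then - 2 * r\<^sup>2 * sin h * cos h else 0) else 0)"

lemma partial_vbds_metric:
  assumes x: "x \<in> vbds_chart I"
  shows "partial k (\<lambda>y. (vbds_metric m q lam) y $ i $ j) x = vbds_dg i j (x$1) (x$2) (x$3) k"
proof (rule partial_vbds_chart[where F="vbds_gtab (vbds_f m q lam) i j" and D="vbds_dg i j (x$1) (x$2) (x$3)", OF x])
  note nz = vbds_chart_nz[OF x]
  show "((\<lambda>u. vbds_gtab (vbds_f m q lam) i j u (x $ 2) (x $ 3)) has_real_derivative vbds_dg i j (x$1) (x$2) (x$3) 1) (at (x $ 1))"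
    using exhaust_4[of i] exhaust_4[of j]
    by (elim disjE) (use nz vbds_f_derivs(1) in \<open>auto simp: vbds_gtab_def vbds_dg_def\<close>)
  show "((\<lambda>u. vbds_gtab (vbds_f m q lam) i j (x $ 1) u (x $ 3)) has_real_derivative vbds_dg i j (x$1) (x$2) (x$3) 2) (at (x $ 2))"
    using exhaust_4[of i] exhaust_4[of j]
    by (elim disjE) (use nz vbds_f_derivs(4) in \<open>auto simp: vbds_gtab_def vbds_dg_def intro!: derivative_eq_intros\<close>)
  show "((\<lambda>u. vbds_gtab (vbds_f m q lam) i j (x $ 1) (x $ 2) u) has_real_derivative vbds_dg i j (x$1) (x$2) (x$3) 3) (at (x $ 3))"
    using exhaust_4[of i] exhaust_4[of j]
    by (elim disjE) (use nz in \<open>auto simp: vbds_gtab_def vbds_dg_def intro!: derivative_eq_intros\<close>)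
qed (auto simp: vbds_dg_def vbds_metric_nth)

lemma christoffel_vbds:
  assumes x: "x \<in> vbds_chart I"
  shows "christoffel (vbds_metric m q lam) a i j x = vbds_Gam (vbds_f m q lam) (vbds_f_t m q) (vbds_f_r m q lam) a i j (x$1) (x$2) (x$3)"
  using exhaust_4[of a] exhaust_4[of i] exhaust_4[of j]
  unfolding christoffel_def sum_4 partial_vbds_metric[OF x] ginv_vbds[OF x]
  by (elim disjE) (use vbds_chart_nz(2,3)[OF x] in
      \<open>simp_all add: vbds_itab_def vbds_Gam_def vbds_dg_def power2_eq_square field_simps\<close>)

definition vbds_dGam :: "4 \<Rightarrow> 4 \<Rightarrow> 4 \<Rightarrow> real \<Rightarrow> real \<Rightarrow> real \<Rightarrow> 4 \<Rightarrow> real" where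
  "vbds_dGam a i j t r h k =
    (if a = 1 then
       (if i = 1 \<and> j = 1 then (if k = 1 then (vbds_f_tr m q) t r / 2 else if k = 2 then (vbds_f_rr m q lam) t r / 2 else 0)
        else if i = 3 \<and> j = 3 then (if k = 2 then -1 else 0)
        else if i = 4 \<and> j = 4 then
          (if k = 2 then - (sin h)\<^sup>2 else if k = 3 then - 2 * r * sin h * cos h else 0)
        else 0)
     else if a = 2 then
       (if i = 1 \<and> j = 1 then
          (if k = 1 then - (vbds_f_tt m q) t r / 2 + ((vbds_f_t m q) t r * (vbds_f_r m q lam) t r + (vbds_f m q lam) t r * (vbds_f_tr m q) t r) / 2
           else if k = 2 then - (vbds_f_tr m q) t r / 2 + ((vbds_f_r m q lam) t r * (vbds_f_r m q lam) t r + (vbds_f m q lam) t r * (vbds_f_rr m q lam) t r) / 2 else 0)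
        else if i = 1 \<and> j = 2 \<or> i = 2 \<and> j = 1 then
          (if k = 1 then - (vbds_f_tr m q) t r / 2 else if k = 2 then - (vbds_f_rr m q lam) t r / 2 else 0)
        else if i = 3 \<and> j = 3 then
          (if k = 1 then - (vbds_f_t m q) t r * r else if k = 2 then - (vbds_f_r m q lam) t r * r - (vbds_f m q lam) t r else 0)
        else if i = 4 \<and> j = 4 then
          (if k = 1 then - (vbds_f_t m q) t r * r * (sin h)\<^sup>2 else if k = 2 then (- (vbds_f_r m q lam) t r * r - (vbds_f m q lam) t r) * (sin h)\<^sup>2
           else if k = 3 then - 2 * (vbds_f m q lam) t r * r * sin h * cos h else 0) else 0)
     else if a = 3 then
       (if i = 2 \<and> j = 3 \<or> i = 3 \<and> j = 2 then (if k = 2 then - (1 / r\<^sup>2) else 0)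
        else if i = 4 \<and> j = 4 then (if k = 3 then (sin h)\<^sup>2 - (cos h)\<^sup>2 else 0) else 0)
     else
       (if i = 2 \<and> j = 4 \<or> i = 4 \<and> j = 2 then (if k = 2 then - (1 / r\<^sup>2) else 0)
        else if i = 3 \<and> j = 4 \<or> i = 4 \<and> j = 3 then (if k = 3 then - 1 - (cos h)\<^sup>2 / (sin h)\<^sup>2 else 0) else 0))"

lemma partial_christoffel_vbds:
  assumes x: "x \<in> vbds_chart I"
  shows "partial k (christoffel (vbds_metric m q lam) a i j) x = vbds_dGam a i j (x$1) (x$2) (x$3) k"
proof (rule partial_vbds_chart[where F="vbds_Gam (vbds_f m q lam) (vbds_f_t m q) (vbds_f_r m q lam) a i j" and D="vbds_dGam a i j (x$1) (x$2) (x$3)", OF x])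
  note nz = vbds_chart_nz[OF x]
  show "((\<lambda>u. vbds_Gam (vbds_f m q lam) (vbds_f_t m q) (vbds_f_r m q lam) a i j u (x $ 2) (x $ 3)) has_real_derivative vbds_dGam a i j (x$1) (x$2) (x$3) 1) (at (x $ 1))"
    using exhaust_4[of a] exhaust_4[of i] exhaust_4[of j]
    by (elim disjE) (use nz in \<open>auto simp: vbds_Gam_def vbds_dGam_def intro!: derivative_eq_intros vbds_f_derivs\<close>)
  show "((\<lambda>u. vbds_Gam (vbds_f m q lam) (vbds_f_t m q) (vbds_f_r m q lam) a i j (x $ 1) u (x $ 3)) has_real_derivative vbds_dGam a i j (x$1) (x$2) (x$3) 2) (at (x $ 2))"
    using exhaust_4[of a] exhaust_4[of i] exhaust_4[of j]
    by (elim disjE) (use nz in \<open>auto intro!: derivative_eq_intros vbds_f_derivs simp: vbds_Gam_def vbds_dGam_def power2_eq_square algebra_simps\<close>)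
  show "((\<lambda>u. vbds_Gam (vbds_f m q lam) (vbds_f_t m q) (vbds_f_r m q lam) a i j (x $ 1) (x $ 2) u) has_real_derivative vbds_dGam a i j (x$1) (x$2) (x$3) 3) (at (x $ 3))"
    using exhaust_4[of a] exhaust_4[of i] exhaust_4[of j]
    by (elim disjE) (use nz in \<open>auto intro!: derivative_eq_intros simp: vbds_Gam_def vbds_dGam_def power2_eq_square field_simps\<close>)
qed (auto simp: vbds_dGam_def christoffel_vbds)

lemma ginv_vbds_contract:
  assumes x: "x \<in> vbds_chart I"
  shows "(\<Sum>e\<in>UNIV. ginv (vbds_metric m q lam) x $ e $ t * (vbds_metric m q lam) x $ e $ a) = (if t = a then 1 else 0)"
  using exhaust_4[of a] exhaust_4[of t]
  unfolding sum_4 vbds_metric_nth ginv_vbds[OF x]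
  by (elim disjE) (use vbds_chart_nz(2,3)[OF x] in \<open>simp_all add: vbds_itab_def vbds_gtab_def\<close>)

definition vbds_Riem where
  "vbds_Riem a p s t u r h = vbds_dGam a p t u r h s - vbds_dGam a p s u r h t +
     (\<Sum>b\<in>UNIV. vbds_Gam (vbds_f m q lam) (vbds_f_t m q) (vbds_f_r m q lam) b p t u r h * vbds_Gam (vbds_f m q lam) (vbds_f_t m q) (vbds_f_r m q lam) a b s u r h
             - vbds_Gam (vbds_f m q lam) (vbds_f_t m q) (vbds_f_r m q lam) b p s u r h * vbds_Gam (vbds_f m q lam) (vbds_f_t m q) (vbds_f_r m q lam) a b t u r h)"

lemma ricci_vbds_Riem:
  assumes x: "x \<in> vbds_chart I"
  shows "ricci (vbds_metric m q lam) x $ p $ s = (\<Sum>t\<in>UNIV. vbds_Riem t p s t (x$1) (x$2) (x$3))"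
proof -
  have "ricci (vbds_metric m q lam) x $ p $ s = (\<Sum>e\<in>UNIV. \<Sum>t\<in>UNIV. \<Sum>a\<in>UNIV.
     ginv (vbds_metric m q lam) x $ e $ t * (vbds_metric m q lam) x $ e $ a * vbds_Riem a p s t (x$1) (x$2) (x$3))"
    by (simp add: ricci_def riemann_def vbds_Riem_def partial_christoffel_vbds[OF x] christoffel_vbds[OF x] sum_distrib_left mult.assoc)
  also have "\<dots> = (\<Sum>t\<in>UNIV. \<Sum>a\<in>UNIV. \<Sum>e\<in>UNIV.
     ginv (vbds_metric m q lam) x $ e $ t * (vbds_metric m q lam) x $ e $ a * vbds_Riem a p s t (x$1) (x$2) (x$3))"
    by (subst sum.swap, rule sum.cong[OF refl], rule sum.swap)
  also have "\<dots> = (\<Sum>t\<in>UNIV. \<Sum>a\<in>UNIV. (if t = a then 1 else 0) * vbds_Riem a p s t (x$1) (x$2) (x$3))"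
    by (simp only: sum_distrib_right[symmetric] ginv_vbds_contract[OF x])
  also have "\<dots> = (\<Sum>t\<in>UNIV. vbds_Riem t p s t (x$1) (x$2) (x$3))"
    by (rule sum.cong[OF refl]) (simp add: if_distrib[where f="\<lambda>z. z * _"] cong: if_cong)
  finally show ?thesis .
qed

definition vbds_S where
  "vbds_S i j t r h =
    (if i = 1 \<and> j = 1 then - ((vbds_f m q lam) t r * (vbds_f_rr m q lam) t r / 2 + (vbds_f m q lam) t r * (vbds_f_r m q lam) t r / r - (vbds_f_t m q) t r / r)
     else if i = 1 \<and> j = 2 \<or> i = 2 \<and> j = 1 then (vbds_f_rr m q lam) t r / 2 + (vbds_f_r m q lam) t r / r
     else if i = 3 \<and> j = 3 then (vbds_f m q lam) t r + r * (vbds_f_r m q lam) t r - 1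
     else if i = 4 \<and> j = 4 then ((vbds_f m q lam) t r + r * (vbds_f_r m q lam) t r - 1) * (sin h)\<^sup>2 else 0)"

lemma ricci_vbds:
  assumes x: "x \<in> vbds_chart I"
  shows "ricci (vbds_metric m q lam) x $ i $ j = vbds_S i j (x$1) (x$2) (x$3)"
  using exhaust_4[of i] exhaust_4[of j]
  unfolding ricci_vbds_Riem[OF x] vbds_Riem_def sum_4
  by (elim disjE; simp only:; simp add: vbds_Gam_def vbds_dGam_def vbds_S_def;
      insert vbds_chart_nz(2,3)[OF x]; simp add: divide_simps; simp add: algebra_simps power2_eq_square)

lemma scalar_curv_vbds:
  assumes x: "x \<in> vbds_chart I"
  shows "scalar_curv (vbds_metric m q lam) x = 4 * lam"
  unfolding scalar_curv_def sum_4 ginv_vbds[OF x] ricci_vbds[OF x]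
  using vbds_chart_nz(2,3)[OF x]
  apply (simp add: vbds_itab_def vbds_S_def vbds_f_def vbds_f_t_def vbds_f_r_def vbds_f_rr_def)
  apply (simp add: divide_simps)
  apply (simp add: algebra_simps eval_nat_numeral)
  done

theorem vbds_field_equation:
  assumes x: "x \<in> vbds_chart I"
  shows "ricci (vbds_metric m q lam) x
           - (scalar_curv (vbds_metric m q lam) x / 2) *\<^sub>R vbds_metric m q lam x
         = vbds_energy_momentum m q lam x"
proof -
  note nz = vbds_chart_nz[OF x]
  have "((\<lambda>u. (q u)\<^sup>2) has_real_derivative 2 * q (x$1) * deriv q (x$1)) (at (x$1))"
    using nz(1) by (auto intro!: derivative_eq_intros vbds_mq_derivs)
  hence qq: "deriv (\<lambda>u. (q u)\<^sup>2) (x$1) = 2 * q (x$1) * deriv q (x$1)"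
    by (rule DERIV_imp_deriv)
  have "ricci (vbds_metric m q lam) x $ i $ j - 2 * lam * vbds_metric m q lam x $ i $ j
         = vbds_energy_momentum m q lam x $ i $ j" for i j
    using exhaust_4[of i] exhaust_4[of j]
    unfolding ricci_vbds[OF x] vbds_metric_nth vbds_energy_momentum_def Let_def qq
    apply (elim disjE)
    apply (simp_all only:)
    apply (simp_all add: vbds_S_def vbds_gtab_def)
    using nz(2,3)
    apply (simp_all add: vbds_f_def vbds_f_t_def vbds_f_r_def vbds_f_rr_def)
    apply (simp_all add: divide_simps)
    apply (simp_all add: algebra_simps eval_nat_numeral)
    done
  thus ?thesis by (simp add: vec_eq_iff scalar_curv_vbds[OF x])
qed

end

end

theory Submission
  imports Defs
begin

text \<open>
  Since the scalar curvature is \<open>4 * lam\<close>, the field equation reads \<open>T = S - 2 * lam * g\<close>, and (i) is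
  linearity of \<open>Q\<close> in its first argument. For (ii), the mixed tensor of \<open>S - c * g\<close> is a multiple
  \<open>\<alpha>\<close> of the identity on the \<open>(t, r)\<close> block, up to a nilpotent part sending \<open>t\<close> to \<open>r\<close>, and a
  multiple \<open>\<beta>\<close> of the identity on the sphere block; compatibility with \<open>R\<close> is then read off from the
  components of \<open>R\<close>. The other curvature tensors differ from \<open>R\<close> by tensors built from \<open>g\<close> and \<open>S\<close>,
  for which compatibility only needs that \<open>T\<close> and its composition with \<open>S\<close> are symmetric.
\<close>

section \<open>Compatibility and the Tachibana tensor\<close>

lemma tachibana_diff_scaleR:
  "tachibana (A - k *\<^sub>R B) W a b c d r s = tachibana A W a b c d r s - k * tachibana B W a b c d r s"
  by (simp add: tachibana_def algebra_simps)

text \<open>Compatibility is linear in the (0,4) tensor, so each derived curvature tensor can be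
  treated summand by summand.\<close>

lemma compatible_at_add:
  assumes "compatible_at g x H D" "compatible_at g x H E"
  shows "compatible_at g x H (\<lambda>e f s t. D e f s t + k * E e f s t)"
  unfolding compatible_at_def
proof (intro allI)
  fix e f s t
  let ?H = "raise_index g x H"
  have "(\<Sum>d\<in>UNIV. ?H e d * (D f s t d + k * E f s t d))
      + (\<Sum>d\<in>UNIV. ?H f d * (D s e t d + k * E s e t d))
      + (\<Sum>d\<in>UNIV. ?H s d * (D e f t d + k * E e f t d))
    = ((\<Sum>d\<in>UNIV. ?H e d * D f s t d) + (\<Sum>d\<in>UNIV. ?H f d * D s e t d)
        + (\<Sum>d\<in>UNIV. ?H s d * D e f t d))
      + k * ((\<Sum>d\<in>UNIV. ?H e d * E f s t d) + (\<Sum>d\<in>UNIV. ?H f d * E s e t d)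
        + (\<Sum>d\<in>UNIV. ?H s d * E e f t d))"
    by (simp add: sum_4 algebra_simps)
  thus "(\<Sum>d\<in>UNIV. ?H e d * (D f s t d + k * E f s t d))
      + (\<Sum>d\<in>UNIV. ?H f d * (D s e t d + k * E s e t d))
      + (\<Sum>d\<in>UNIV. ?H s d * (D e f t d + k * E e f t d)) = 0"
    using assms by (simp add: compatible_at_def)
qed

lemma metric_ginv_contract:
  assumes "invertible (g x)"
  shows "(\<Sum>d\<in>UNIV. g x $ f $ d * ginv g x $ d $ a) = (if f = a then 1 else 0)"
proof -
  have "\<exists>B. g x ** B = mat 1 \<and> B ** g x = mat 1"
    using assms by (simp add: invertible_def)
  hence "g x ** ginv g x = mat 1"
    unfolding ginv_def matrix_inv_def by (rule someI2_ex) simp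
  thus ?thesis
    by (simp add: vec_eq_iff matrix_matrix_mult_def mat_def)
qed

text \<open>The contracted index pairs \<open>g\<close> with its inverse and leaves a Kronecker
  delta.\<close>

lemma raise_index_lower:
  assumes "invertible (g x)"
  shows "(\<Sum>d\<in>UNIV. raise_index g x H e d * g x $ f $ d) = H $ e $ f"
proof -
  have "(\<Sum>d\<in>UNIV. raise_index g x H e d * g x $ f $ d)
      = (\<Sum>a\<in>UNIV. \<Sum>d\<in>UNIV. H $ e $ a * (g x $ f $ d * ginv g x $ d $ a))"
    unfolding raise_index_def sum_distrib_right
    by (subst sum.swap) (simp add: mult_ac)
  also have "\<dots> = H $ e $ f"
    by (simp only: sum_distrib_left[symmetric] metric_ginv_contract[of g, OF assms])
      (simp add: if_distrib[where f="\<lambda>z. _ * z"] cong: if_cong)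
  finally show ?thesis .
qed

text \<open>Contracting the last slot leaves terms \<open>H\<close> times \<open>B\<close> and terms
  \<open>g\<close> times the composition of \<open>H\<close> with \<open>B\<close>. In the cyclic
  sum each occurs twice with opposite signs, up to swapping the two indices of \<open>H\<close> or
  of the composition.\<close>

lemma compatible_at_kulkarni_nomizu:
  assumes "invertible (g x)" and H: "\<And>i j. H $ i $ j = H $ j $ i"
    and HB: "\<And>e f. (\<Sum>d\<in>UNIV. raise_index g x H e d * B $ f $ d)
                    = (\<Sum>d\<in>UNIV. raise_index g x H f d * B $ e $ d)"
  shows "compatible_at g x H (kulkarni_nomizu (g x) B)"
proof -
  let ?HB = "\<lambda>e f. \<Sum>d\<in>UNIV. raise_index g x H e d * B $ f $ d"
  have "(\<Sum>d\<in>UNIV. raise_index g x H e d * kulkarni_nomizu (g x) B f s t d)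
      = (\<Sum>d\<in>UNIV. raise_index g x H e d * g x $ f $ d) * B $ s $ t + g x $ s $ t * ?HB e f
        - g x $ f $ t * ?HB e s - (\<Sum>d\<in>UNIV. raise_index g x H e d * g x $ s $ d) * B $ f $ t"
    for e f s t
    by (simp add: kulkarni_nomizu_def sum_4 algebra_simps)
  hence contr: "(\<Sum>d\<in>UNIV. raise_index g x H e d * kulkarni_nomizu (g x) B f s t d)
      = H $ e $ f * B $ s $ t + g x $ s $ t * ?HB e f
        - g x $ f $ t * ?HB e s - H $ e $ s * B $ f $ t" for e f s t
    by (simp only: raise_index_lower[of g, OF assms(1)])
  show ?thesis
    unfolding compatible_at_def
  proof (intro allI)
    fix e f s t
    show "(\<Sum>d\<in>UNIV. raise_index g x H e d * kulkarni_nomizu (g x) B f s t d)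
        + (\<Sum>d\<in>UNIV. raise_index g x H f d * kulkarni_nomizu (g x) B s e t d)
        + (\<Sum>d\<in>UNIV. raise_index g x H s d * kulkarni_nomizu (g x) B e f t d) = 0"
      unfolding contr HB[of f e] HB[of s e] HB[of s f] H[of f e] H[of s e] H[of s f]
      by simp
  qed
qed

text \<open>Here the contraction meets only \<open>g\<close>, so no composition appears and the
  terms \<open>H\<close> times \<open>B\<close> cancel in pairs.\<close>

lemma compatible_at_projective_part:
  assumes "invertible (g x)" and H: "\<And>i j. H $ i $ j = H $ j $ i"
  shows "compatible_at g x H (\<lambda>e f s t. g x $ e $ t * B $ f $ s - g x $ f $ t * B $ e $ s)"
proof -
  have "(\<Sum>d\<in>UNIV. raise_index g x H e d * (g x $ f $ d * B $ s $ t - g x $ s $ d * B $ f $ t))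
      = (\<Sum>d\<in>UNIV. raise_index g x H e d * g x $ f $ d) * B $ s $ t
        - (\<Sum>d\<in>UNIV. raise_index g x H e d * g x $ s $ d) * B $ f $ t" for e f s t
    by (simp add: sum_4 algebra_simps)
  hence contr: "(\<Sum>d\<in>UNIV. raise_index g x H e d * (g x $ f $ d * B $ s $ t - g x $ s $ d * B $ f $ t))
      = H $ e $ f * B $ s $ t - H $ e $ s * B $ f $ t" for e f s t
    by (simp only: raise_index_lower[of g, OF assms(1)])
  show ?thesis
    unfolding compatible_at_def
  proof (intro allI)
    fix e f s t
    show "(\<Sum>d\<in>UNIV. raise_index g x H e d * (g x $ f $ d * B $ s $ t - g x $ s $ d * B $ f $ t))
        + (\<Sum>d\<in>UNIV. raise_index g x H f d * (g x $ s $ d * B $ e $ t - g x $ e $ d * B $ s $ t))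
        + (\<Sum>d\<in>UNIV. raise_index g x H s d * (g x $ e $ d * B $ f $ t - g x $ f $ d * B $ e $ t)) = 0"
      unfolding contr H[of f e] H[of s e] H[of s f] by simp
  qed
qed

section \<open>Curvature of the Vaidya-Bonner-de Sitter metric\<close>

text \<open>For distinct \<open>i\<close>, \<open>j\<close>: the components of the basic 2-form dx^i
  wedge dx^j.\<close>

definition alt2 :: "4 \<Rightarrow> 4 \<Rightarrow> 4 \<Rightarrow> 4 \<Rightarrow> real" where
  "alt2 i j e f = (if e = i \<and> f = j then 1 else 0) - (if e = j \<and> f = i then 1 else 0)"

text \<open>A curvature tensor as a symmetric form on basic 2-forms, with components R_1212 = A,
  R_1313 = B, R_1323 = C, R_3434 = D. Replacing the index 3 by 4 in B and C costs the factor
  \<sigma>, the ratio g_44 / g_33. There is no 2323 or 2424 term.\<close>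

definition warped_curv :: "real \<Rightarrow> real \<Rightarrow> real \<Rightarrow> real \<Rightarrow> real \<Rightarrow> tensor4" where
  "warped_curv A B C D \<sigma> e f s t =
     A * (alt2 1 2 e f * alt2 1 2 s t)
     + B * (alt2 1 3 e f * alt2 1 3 s t + \<sigma> * (alt2 1 4 e f * alt2 1 4 s t))
     + C * (alt2 1 3 e f * alt2 2 3 s t + alt2 2 3 e f * alt2 1 3 s t
            + \<sigma> * (alt2 1 4 e f * alt2 2 4 s t + alt2 2 4 e f * alt2 1 4 s t))
     + D * (alt2 3 4 e f * alt2 3 4 s t)"

definition mixed_block :: "real \<Rightarrow> real \<Rightarrow> real \<Rightarrow> 4 \<Rightarrow> 4 \<Rightarrow> real" where
  "mixed_block \<alpha> \<beta> \<gamma> e d =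
     (if e = d then if e = 1 \<or> e = 2 then \<alpha> else \<beta> else if e = 1 \<and> d = 2 then \<gamma> else 0)"

lemma alt2_swap: "alt2 i j f e = - alt2 i j e f"
  by (simp only: alt2_def minus_diff_eq conj_commute)

lemma warped_curv_swap:
  "warped_curv A B C D \<sigma> f e s t = - warped_curv A B C D \<sigma> e f s t"
  "warped_curv A B C D \<sigma> e f t s = - warped_curv A B C D \<sigma> e f s t"
  unfolding warped_curv_def alt2_swap[of _ _ f e] alt2_swap[of _ _ t s]
  by (simp_all add: algebra_simps)

text \<open>
  The cyclic sum is alternating in \<open>e\<close>, \<open>f\<close>, \<open>s\<close>, so only the four increasing triples need to be
  computed.
\<close>

lemma mixed_block_warped_curv_cyclic:
  "(\<Sum>d\<in>UNIV. mixed_block \<alpha> \<beta> \<gamma> e d * warped_curv A B C D \<sigma> f s t d)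
   + (\<Sum>d\<in>UNIV. mixed_block \<alpha> \<beta> \<gamma> f d * warped_curv A B C D \<sigma> s e t d)
   + (\<Sum>d\<in>UNIV. mixed_block \<alpha> \<beta> \<gamma> s d * warped_curv A B C D \<sigma> e f t d) = 0"
proof -
  define K where "K e f s = (\<Sum>d\<in>UNIV. mixed_block \<alpha> \<beta> \<gamma> e d * warped_curv A B C D \<sigma> f s t d)" for e f s
  define Z where "Z e f s = K e f s + K f s e + K s e f" for e f s
  have swap: "K e s f = - K e f s" for e f s
    unfolding K_def warped_curv_swap(1)[of _ _ _ _ _ s f] by (simp add: sum_negf)
  have alt: "Z f e s = - Z e f s" "Z f s e = Z e f s" for e f s
    using swap[of f s e] swap[of e f s] swap[of s e f] by (simp_all add: Z_def)
  \<comment> \<open>With one sphere index, the two C terms cancel because 1 and 2 share the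
    eigenvalue \<alpha>, while \<gamma> meets only the vanishing 2323 and 2424 components. With two
    sphere indices every term is zero.\<close>
  have triples: "Z 1 2 3 = 0 \<and> Z 1 2 4 = 0 \<and> Z 1 3 4 = 0 \<and> Z 2 3 4 = 0"
    unfolding Z_def K_def sum_4 using exhaust_4[of t]
    by (elim disjE; simp only:; simp add: mixed_block_def warped_curv_def alt2_def)
  have perms: "Z i k j = 0 \<and> Z j i k = 0 \<and> Z j k i = 0 \<and> Z k i j = 0 \<and> Z k j i = 0"
    if "Z i j k = 0" for i j k
    using that alt by (metis neg_equal_0_iff_equal)
  have "Z i i j = 0" for i j
    using alt(1)[of i i j] by simp
  hence diag: "Z i i j = 0 \<and> Z i j i = 0 \<and> Z j i i = 0" for i j
    using alt(2) by metis
  have "Z e f s = 0"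
    using exhaust_4[of e] exhaust_4[of f] exhaust_4[of s]
    by (elim disjE; simp only: diag triples perms[of 1 2 3] perms[of 1 2 4] perms[of 1 3 4] perms[of 2 3 4])
  thus ?thesis
    by (simp add: Z_def K_def)
qed

section \<open>Riemann tensor and mixed tensor of \<open>S - c * g\<close> in coordinates\<close>

context
  fixes m q :: "real \<Rightarrow> real" and lam :: real and I :: "real set"
  assumes I: "open I"
    and m: "\<And>t. t \<in> I \<Longrightarrow> m differentiable (at t) \<and> deriv m differentiable (at t)"
    and q: "\<And>t. t \<in> I \<Longrightarrow> q differentiable (at t) \<and> deriv q differentiable (at t)"
begin

lemma invertible_vbds_metric:
  assumes x: "x \<in> vbds_chart I"
  shows "invertible (vbds_metric m q lam x)"
proof -
  \<comment> \<open>\<open>ginv_vbds_contract\<close> sums over the first index of both matrices,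
    hence the transpose.\<close>
  have "transpose (ginv (vbds_metric m q lam) x) ** vbds_metric m q lam x = mat 1"
    using ginv_vbds_contract[OF I m q x]
    by (simp add: vec_eq_iff matrix_matrix_mult_def transpose_def mat_def)
  thus ?thesis
    by (metis invertible_def matrix_left_right_inverse)
qed

text \<open>\<open>vbds_Riem\<close> carries a raised first index, so the covariant model
  \<open>W\<close> is raised for the comparison. Both sides are antisymmetric in \<open>s\<close>
  and \<open>t\<close>, which leaves six index pairs to compute.\<close>

lemma vbds_Riem_eq:
  assumes x: "x \<in> vbds_chart I"
  defines "F \<equiv> vbds_f m q lam (x$1) (x$2)" and "Ft \<equiv> vbds_f_t m q (x$1) (x$2)"
    and "Fr \<equiv> vbds_f_r m q lam (x$1) (x$2)" and "Frr \<equiv> vbds_f_rr m q lam (x$1) (x$2)"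
  defines "W \<equiv> warped_curv (- Frr / 2) (x$2 * (Ft - F * Fr) / 2) (x$2 * Fr / 2)
      ((x$2)\<^sup>2 * (sin (x$3))\<^sup>2 * (F - 1)) ((sin (x$3))\<^sup>2)"
  shows "vbds_Riem m q lam a p s t (x$1) (x$2) (x$3)
       = (\<Sum>e\<in>UNIV. ginv (vbds_metric m q lam) x $ a $ e * W e p s t)" (is "?L s t = ?R s t")
proof -
  have ordered: "?L s t = ?R s t"
    if "s = 1 \<and> t = 2 \<or> s = 1 \<and> t = 3 \<or> s = 1 \<and> t = 4 \<or> s = 2 \<and> t = 3 \<or> s = 2 \<and> t = 4 \<or> s = 3 \<and> t = 4"
    for s t
    using that exhaust_4[of a] exhaust_4[of p]
    by (elim disjE conjE; simp only: vbds_Riem_def[OF I m q] sum_4 ginv_vbds[OF I m q x];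
        simp add: vbds_itab_def vbds_Gam_def vbds_dGam_def[OF I m q];
        simp add: W_def warped_curv_def alt2_def F_def Ft_def Fr_def Frr_def;
        insert vbds_chart_nz(2,3)[OF I m q x]; simp add: divide_simps;
        simp add: algebra_simps power2_eq_square)
  have alt: "?L t s = - ?L s t" "?R t s = - ?R s t" for s t
    unfolding W_def warped_curv_swap(2)[of _ _ _ _ _ _ _ t s]
    by (simp_all add: vbds_Riem_def[OF I m q] sum_negf sum_subtractf)
  show ?thesis
  proof (cases "s = t")
    case True
    thus ?thesis using alt[of s s] by simp
  next
    case False
    then consider "?L s t = ?R s t" | "?L t s = ?R t s"
      using exhaust_4[of s] exhaust_4[of t] ordered[of s t] ordered[of t s] by blast
    thus ?thesis by cases (use alt[of s t] in simp_all)
  qed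
qed

text \<open>Lowering the first index cancels the inverse metric in
  \<open>vbds_Riem_eq\<close>.\<close>

lemma riemann_vbds:
  assumes x: "x \<in> vbds_chart I"
  defines "F \<equiv> vbds_f m q lam (x$1) (x$2)" and "Ft \<equiv> vbds_f_t m q (x$1) (x$2)"
    and "Fr \<equiv> vbds_f_r m q lam (x$1) (x$2)" and "Frr \<equiv> vbds_f_rr m q lam (x$1) (x$2)"
  shows "riemann (vbds_metric m q lam) x e f s t =
    warped_curv (- Frr / 2) (x$2 * (Ft - F * Fr) / 2) (x$2 * Fr / 2)
      ((x$2)\<^sup>2 * (sin (x$3))\<^sup>2 * (F - 1)) ((sin (x$3))\<^sup>2) e f s t" (is "_ = ?W e f s t")
proof -
  let ?g = "vbds_metric m q lam"
  have "riemann ?g x e f s t = (\<Sum>a\<in>UNIV. ?g x $ e $ a * vbds_Riem m q lam a f s t (x$1) (x$2) (x$3))"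
    by (simp add: riemann_def vbds_Riem_def[OF I m q] partial_christoffel_vbds[OF I m q] christoffel_vbds[OF I m q] x)
  also have "\<dots> = (\<Sum>a\<in>UNIV. \<Sum>b\<in>UNIV. ?g x $ e $ a * ginv ?g x $ a $ b * ?W b f s t)"
    by (simp only: vbds_Riem_eq[OF x] F_def Ft_def Fr_def Frr_def sum_distrib_left mult.assoc)
  also have "\<dots> = (\<Sum>b\<in>UNIV. (\<Sum>a\<in>UNIV. ?g x $ e $ a * ginv ?g x $ a $ b) * ?W b f s t)"
    by (subst sum.swap) (simp only: sum_distrib_right)
  also have "\<dots> = ?W e f s t"
    by (simp add: metric_ginv_contract[of "vbds_metric m q lam", OF invertible_vbds_metric[OF x]] if_distrib[where f="\<lambda>z. z * _"] cong: if_cong)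
  finally show ?thesis .
qed

text \<open>On the (t, r) block, S is -(Frr/2 + Fr/r) times g plus Ft/r times the square of dt.
  Raising the null form dt gives minus the r direction, whence the nilpotent entry -Ft/r.\<close>

lemma raise_index_vbds:
  assumes x: "x \<in> vbds_chart I"
  defines "F \<equiv> vbds_f m q lam (x$1) (x$2)" and "Ft \<equiv> vbds_f_t m q (x$1) (x$2)"
    and "Fr \<equiv> vbds_f_r m q lam (x$1) (x$2)" and "Frr \<equiv> vbds_f_rr m q lam (x$1) (x$2)"
  shows "raise_index (vbds_metric m q lam) x (ricci (vbds_metric m q lam) x - c *\<^sub>R vbds_metric m q lam x) e d =
    mixed_block (- Frr / 2 - Fr / x$2 - c) (- (F + x$2 * Fr - 1) / (x$2)\<^sup>2 - c) (- Ft / x$2) e d"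
  using exhaust_4[of e] exhaust_4[of d]
  by (elim disjE; simp only: raise_index_def sum_4 ginv_vbds[OF I m q x] vector_minus_component
        vector_scaleR_component ricci_vbds[OF I m q x] vbds_metric_nth;
      simp add: vbds_itab_def vbds_gtab_def vbds_S_def[OF I m q] mixed_block_def F_def Ft_def Fr_def Frr_def;
      insert vbds_chart_nz(2,3)[OF I m q x]; simp add: divide_simps;
      simp add: algebra_simps power2_eq_square)

lemma vbds_metric_sym: "vbds_metric m q lam x $ i $ j = vbds_metric m q lam x $ j $ i"
  by (auto simp: vbds_metric_nth vbds_gtab_def)

lemma ricci_vbds_sym:
  assumes "x \<in> vbds_chart I"
  shows "ricci (vbds_metric m q lam) x $ i $ j = ricci (vbds_metric m q lam) x $ j $ i"
  by (auto simp: ricci_vbds[OF I m q assms] vbds_S_def[OF I m q])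

lemma compatible_at_vbds:
  fixes c :: real
  assumes x: "x \<in> vbds_chart I"
  defines "g \<equiv> vbds_metric m q lam"
  defines "H \<equiv> ricci g x - c *\<^sub>R g x"
  shows "compatible_at g x H (riemann g x)" "compatible_at g x H (projective g x)"
    "compatible_at g x H (conformal g x)" "compatible_at g x H (concircular g x)"
    "compatible_at g x H (conharmonic g x)"
proof -
  have inv: "invertible (g x)" and gs: "g x $ i $ j = g x $ j $ i"
    and Ss: "ricci g x $ i $ j = ricci g x $ j $ i" for i j
    using invertible_vbds_metric vbds_metric_sym ricci_vbds_sym x by (auto simp: g_def)
  have Hs: "H $ i $ j = H $ j $ i" for i j
    unfolding H_def vector_minus_component vector_scaleR_component using gs Ss by presburger
  show R: "compatible_at g x H (riemann g x)"
    unfolding compatible_at_def g_def H_def raise_index_vbds[OF x] riemann_vbds[OF x]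
    by (intro allI mixed_block_warped_curv_cyclic)
  have P: "compatible_at g x H
      (\<lambda>e f s t. g x $ e $ t * ricci g x $ f $ s - g x $ f $ t * ricci g x $ e $ s)"
    by (rule compatible_at_projective_part[of g, OF inv Hs])
  \<comment> \<open>For \<open>B = g\<close> the composition is \<open>H\<close> itself.\<close>
  have gg: "compatible_at g x H (kulkarni_nomizu (g x) (g x))"
    by (rule compatible_at_kulkarni_nomizu[of g, OF inv Hs])
      (simp only: raise_index_lower[of g, OF inv] Hs)
  \<comment> \<open>The composition of S - c g with S is S composed with itself minus c S, hence
    symmetric; the normal form of the mixed tensor makes this a finite check.\<close>
  have "(\<Sum>d\<in>UNIV. raise_index g x H e d * ricci g x $ f $ d)
      = (\<Sum>d\<in>UNIV. raise_index g x H f d * ricci g x $ e $ d)" for e f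
    unfolding g_def H_def raise_index_vbds[OF x] sum_4
    using exhaust_4[of e] exhaust_4[of f]
    by (elim disjE; simp only:; simp add: ricci_vbds[OF I m q x] mixed_block_def vbds_S_def[OF I m q])
  hence gS: "compatible_at g x H (kulkarni_nomizu (g x) (ricci g x))"
    by (rule compatible_at_kulkarni_nomizu[of g, OF inv Hs])
  show "compatible_at g x H (projective g x)"
    using compatible_at_add[OF R P, of "-1/3"] by (simp add: projective_def[abs_def])
  show har: "compatible_at g x H (conharmonic g x)"
    using compatible_at_add[OF R gS, of "-1/2"] by (simp add: conharmonic_def[abs_def])
  show "compatible_at g x H (concircular g x)"
    using compatible_at_add[OF R gg, of "- scalar_curv g x / 24"]
    by (simp add: concircular_def[abs_def])
  \<comment> \<open>C differs from har(R) only by a multiple of the product of \<open>g\<close> with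
    itself.\<close>
  show "compatible_at g x H (conformal g x)"
    using compatible_at_add[OF har gg, of "scalar_curv g x / 12"]
    by (simp add: conformal_def[abs_def] conharmonic_def[abs_def])
qed

end

theorem theorem5p1:
  fixes m q :: "real \<Rightarrow> real" and lam :: real and I :: "real set"
    and g T :: "real ^ 4 \<Rightarrow> real ^ 4 ^ 4"
  assumes "open I"
    and "\<And>t. t \<in> I \<Longrightarrow> m differentiable (at t) \<and> deriv m differentiable (at t)"
    and "\<And>t. t \<in> I \<Longrightarrow> q differentiable (at t) \<and> deriv q differentiable (at t)"
  defines "g \<equiv> vbds_metric m q lam"
    and "T \<equiv> vbds_energy_momentum m q lam"
  shows "\<forall>x\<in>vbds_chart I.
      (\<forall>a b c d r s.
         tachibana (T x) (riemann g x) a b c d r s =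
           - 2 * lam * tachibana (g x) (riemann g x) a b c d r s
             + tachibana (ricci g x) (riemann g x) a b c d r s)
      \<and> compatible_at g x (T x) (riemann g x)
      \<and> compatible_at g x (T x) (projective g x)
      \<and> compatible_at g x (T x) (conformal g x)
      \<and> compatible_at g x (T x) (concircular g x)
      \<and> compatible_at g x (T x) (conharmonic g x)"
proof
  fix x assume x: "x \<in> vbds_chart I"
  note vbds = assms(1-3) x
  have T: "T x = ricci g x - (2 * lam) *\<^sub>R g x"
    using vbds_field_equation[OF vbds, of lam] scalar_curv_vbds[OF vbds, of lam]
    by (simp add: g_def T_def)
  show "(\<forall>a b c d r s.
         tachibana (T x) (riemann g x) a b c d r s =
           - 2 * lam * tachibana (g x) (riemann g x) a b c d r s
             + tachibana (ricci g x) (riemann g x) a b c d r s)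
      \<and> compatible_at g x (T x) (riemann g x)
      \<and> compatible_at g x (T x) (projective g x)
      \<and> compatible_at g x (T x) (conformal g x)
      \<and> compatible_at g x (T x) (concircular g x)
      \<and> compatible_at g x (T x) (conharmonic g x)"
    unfolding T tachibana_diff_scaleR
    using compatible_at_vbds[OF vbds, of lam "2 * lam"] by (simp add: g_def)
qed

end
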